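(* For integers $a,b\ge0$ let $\rho_{a\times b}$ be the $a\times b$ rectangle poset. Then \[\sum_{a\ge0}\sum_{b\ge0}|\mathbf{E}(J(\rho_{a\times b}))|\,x^b y^a=\frac{(1+x)(1+y)}{1-(1+x)y^2-(1+y)x^2}.\]
   Context: $\rho_{a\times b}$ is the rectangular Young diagram with $a$ rows of size $b$, viewed as a poset on its boxes, where a box is $\le$ another iff it lies weakly northwest of it (equivalently, the product of an $a$-element chain and a $b$-element chain). $J(Q)$ is the lattice of order ideals of $Q$ ordered by containment. For a finite lattice $L$ and $x\in L$, an Ungar move sends $x$ to $\bigwedge(\{x\}\cup T)$ with $T$ a subset of the elements covered by $x$; it is nontrivial if $T\neq\emptyset$. An element $x$ is an Eeta win in $L$ if, in the game on the interval $[\hat0,x]$ where starting at $x$ two players (Atniss first, then Eeta) alternately make nontrivial Ungar moves and the player unable to move loses, Atniss has no winning strategy; recursively, $\hat0$ is an Eeta win and $x$ is an Eeta win iff every element obtainable from $x$ by a nontrivial Ungar move is not an Eeta win. $\mathbf{E}(L)$ is the set of Eeta wins in $L$. *)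

theory Defs
  imports "HOL-Algebra.Lattice" "HOL-Computational_Algebra.Formal_Power_Series"
begin

definition covers :: "('a, 'm) gorder_scheme \<Rightarrow> 'a \<Rightarrow> 'a \<Rightarrow> bool" where
  "covers L x y \<longleftrightarrow> x \<in> carrier L \<and> y \<in> carrier L \<and> y \<sqsubset>\<^bsub>L\<^esub> x \<and>
     \<not> (\<exists>z\<in>carrier L. y \<sqsubset>\<^bsub>L\<^esub> z \<and> z \<sqsubset>\<^bsub>L\<^esub> x)"

definition ungar_move :: "('a, 'm) gorder_scheme \<Rightarrow> 'a \<Rightarrow> 'a set \<Rightarrow> 'a" where
  "ungar_move L x T = \<Sqinter>\<^bsub>L\<^esub> ({x} \<union> T)"

definition nontrivial_ungar_move :: "('a, 'm) gorder_scheme \<Rightarrow> 'a \<Rightarrow> 'a \<Rightarrow> bool" where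
  "nontrivial_ungar_move L x y \<longleftrightarrow> x \<in> carrier L \<and>
     (\<exists>T. T \<subseteq> {t. covers L x t} \<and> T \<noteq> {} \<and> y = ungar_move L x T)"

text \<open>
  \<open>atniss_wins L x\<close>: the player to move at \<open>x\<close> (Atniss, if the game starts there) has a
  winning strategy, i.e. a move such that after every reply she again has one; the case of no reply
  is the base case.  The elements covered by \<open>x\<close> and their meets are the same in \<open>L\<close>
  and in the interval from the bottom to \<open>x\<close>, so the game is played in \<open>L\<close> itself.
\<close>

inductive atniss_wins :: "('a, 'm) gorder_scheme \<Rightarrow> 'a \<Rightarrow> bool" for L where
  "nontrivial_ungar_move L x y \<Longrightarrow>
   (\<And>z. nontrivial_ungar_move L y z \<Longrightarrow> atniss_wins L z) \<Longrightarrow> atniss_wins L x"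

definition eeta_wins :: "('a, 'm) gorder_scheme \<Rightarrow> 'a set" where
  "eeta_wins L = {x \<in> carrier L. \<not> atniss_wins L x}"

lemma nontrivial_ungar_move_less:
  assumes "lattice L" "finite (carrier L)" "nontrivial_ungar_move L x y"
  shows "y \<in> carrier L" "y \<sqsubset>\<^bsub>L\<^esub> x"
proof -
  interpret lattice L by fact
  obtain T where T: "T \<subseteq> {t. covers L x t}" "T \<noteq> {}" "y = \<Sqinter>\<^bsub>L\<^esub> ({x} \<union> T)" "x \<in> carrier L"
    using assms(3) by (auto simp: nontrivial_ungar_move_def ungar_move_def)
  have sub: "{x} \<union> T \<subseteq> carrier L"
    using T by (auto simp: covers_def)
  then have g: "greatest L y (Lower L ({x} \<union> T))"
    using T(3) finite_inf_greatest[of "{x} \<union> T"] finite_subset[OF _ assms(2)] by auto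
  then show y: "y \<in> carrier L" by blast
  obtain t where t: "t \<in> T" "covers L x t" using T by auto
  have "y \<sqsubseteq>\<^bsub>L\<^esub> t" "y \<sqsubseteq>\<^bsub>L\<^esub> x"
    using g sub t(1) by (auto intro: greatest_Lower_below)
  then show "y \<sqsubset>\<^bsub>L\<^esub> x"
    using t y by (auto simp: covers_def lless_def eq_is_equal intro: le_antisym)
qed

lemma mem_eeta_wins_iff:
  assumes L: "lattice L" "finite (carrier L)" and x: "x \<in> carrier L"
  shows "x \<in> eeta_wins L \<longleftrightarrow> (\<forall>y. nontrivial_ungar_move L x y \<longrightarrow> y \<notin> eeta_wins L)"
proof -
  interpret lattice L by fact
  have step: "atniss_wins L x \<longleftrightarrow> (\<exists>y. nontrivial_ungar_move L x y \<and> \<not> atniss_wins L y)"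
    if "x \<in> carrier L" for x
    using that
  proof (induction "card {z \<in> carrier L. z \<sqsubset>\<^bsub>L\<^esub> x}" arbitrary: x rule: less_induct)
    case less
    have IH: "atniss_wins L y \<longleftrightarrow> (\<exists>z. nontrivial_ungar_move L y z \<and> \<not> atniss_wins L z)"
      if m: "nontrivial_ungar_move L x y" for y
    proof (rule less.hyps)
      note y = nontrivial_ungar_move_less[OF L m]
      show "y \<in> carrier L" by (fact y)
      have "{z \<in> carrier L. z \<sqsubset>\<^bsub>L\<^esub> y} \<subset> {z \<in> carrier L. z \<sqsubset>\<^bsub>L\<^esub> x}"
        using y less.prems lless_trans[of _ y x] by (auto simp: lless_def)
      then show "card {z \<in> carrier L. z \<sqsubset>\<^bsub>L\<^esub> y} < card {z \<in> carrier L. z \<sqsubset>\<^bsub>L\<^esub> x}"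
        using L(2) by (intro psubset_card_mono) auto
    qed
    show ?case
      by (subst atniss_wins.simps) (use IH in blast)
  qed
  show ?thesis
    using step[OF x] x nontrivial_ungar_move_less(1)[OF L, of x] by (auto simp: eeta_wins_def)
qed

definition rect_poset :: "nat \<Rightarrow> nat \<Rightarrow> (nat \<times> nat) gorder" where
  "rect_poset a b = \<lparr>carrier = {..<a} \<times> {..<b}, eq = (=),
     le = (\<lambda>(i, j) (i', j'). i \<le> i' \<and> j \<le> j')\<rparr>"

definition order_ideal :: "('a, 'm) gorder_scheme \<Rightarrow> 'a set \<Rightarrow> bool" where
  "order_ideal Q I \<longleftrightarrow> I \<subseteq> carrier Q \<and> (\<forall>p\<in>I. \<forall>q\<in>carrier Q. q \<sqsubseteq>\<^bsub>Q\<^esub> p \<longrightarrow> q \<in> I)"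

definition ideal_lattice :: "('a, 'm) gorder_scheme \<Rightarrow> 'a set gorder" where
  "ideal_lattice Q = \<lparr>carrier = {I. order_ideal Q I}, eq = (=), le = (\<subseteq>)\<rparr>"

lemma lattice_ideal_lattice: "lattice (ideal_lattice Q)"
proof
  fix I K assume "I \<in> carrier (ideal_lattice Q)" "K \<in> carrier (ideal_lattice Q)"
  then have oi: "order_ideal Q I" "order_ideal Q K" by (simp_all add: ideal_lattice_def)
  have "least (ideal_lattice Q) (I \<union> K) (Upper (ideal_lattice Q) {I, K})"
    using oi by (auto simp: least_def Upper_def ideal_lattice_def order_ideal_def)
  then show "\<exists>s. least (ideal_lattice Q) s (Upper (ideal_lattice Q) {I, K})" ..
  have "greatest (ideal_lattice Q) (I \<inter> K) (Lower (ideal_lattice Q) {I, K})"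
    using oi by (auto simp: greatest_def Lower_def ideal_lattice_def order_ideal_def)
  then show "\<exists>s. greatest (ideal_lattice Q) s (Lower (ideal_lattice Q) {I, K})" ..
qed (auto simp: ideal_lattice_def)

lemma finite_ideal_lattice: "finite (carrier Q) \<Longrightarrow> finite (carrier (ideal_lattice Q))"
  by (rule finite_subset[of _ "Pow (carrier Q)"]) (auto simp: ideal_lattice_def order_ideal_def)

text \<open>
  Formal power series in \<open>x\<close> and \<open>y\<close> are modelled as power series in \<open>y\<close> whose coefficients are
  power series in \<open>x\<close>.
\<close>

definition fps_x :: "rat fps fps" where
  "fps_x = fps_const fps_X"

definition fps_y :: "rat fps fps" where
  "fps_y = fps_X"

text \<open>\<open>bivariate_gf c\<close> is the sum of all \<open>c a b * x ^ b * y ^ a\<close>.\<close>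

definition bivariate_gf :: "(nat \<Rightarrow> nat \<Rightarrow> rat) \<Rightarrow> rat fps fps" where
  "bivariate_gf c = Abs_fps (\<lambda>a. Abs_fps (\<lambda>b. c a b))"

text \<open>
  As \<open>rat fps\<close> is not a field, division in \<open>rat fps fps\<close> is a genuine quotient only for suitable
  denominators, such as those whose constant coefficient (in \<open>y\<close>) is a unit.
\<close>

lemma eq_divide_iff_fps_fps:
  fixes F N D :: "rat fps fps"
  assumes "fps_nth (fps_nth D 0) 0 \<noteq> 0"
  shows "F = N / D \<longleftrightarrow> F * D = N"
proof -
  have nz: "fps_nth D 0 \<noteq> 0" using assms by auto
  then have sd: "subdegree D = 0" by simp
  have inv: "D * inverse D = 1"
    using fps_right_inverse[OF inverse_mult_eq_1'[OF assms]] by (simp add: fps_inverse_def)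
  have "N / D = N * inverse D"
    using sd by (simp add: fps_divide_def)
  moreover have "N * inverse D * D = N" for N
    using inv by (simp add: mult.assoc mult.commute[of "inverse D"])
  moreover have "F * D * inverse D = F"
    using inv by (simp add: mult.assoc)
  ultimately show ?thesis by auto
qed

lemma denominator_unit:
  "fps_nth (fps_nth (1 - (1 + fps_x) * fps_y\<^sup>2 - (1 + fps_y) * fps_x\<^sup>2) 0) 0 = 1"
  by (simp add: fps_x_def fps_y_def fps_mult_nth power2_eq_square)

end

theory Submission
  imports Defs
begin

text \<open>
  An order ideal of the rectangle is a lattice path, i.e. a word in \<open>1\<close> (row step) and \<open>0\<close> (column
  step), and an Ungar move replaces some disjoint factors \<open>10\<close> by \<open>01\<close>.  The Eeta wins turn out to be
  the words in which no maximal run of \<open>1\<close>s of odd length is followed by a maximal run of \<open>0\<close>s of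
  odd length.  These are recognised by a finite automaton; comparing the runs of the automaton on
  a word and on the word after a move shows that they form the kernel of the game, and the
  transitions of the automaton give a linear system for the generating function.
\<close>

section \<open>Ungar moves in lattices of order ideals\<close>

definition maximal_in :: "('a, 'm) gorder_scheme \<Rightarrow> 'a set \<Rightarrow> 'a \<Rightarrow> bool" where
  "maximal_in Q I p \<longleftrightarrow> p \<in> I \<and> (\<forall>q\<in>I. p \<sqsubseteq>\<^bsub>Q\<^esub> q \<longrightarrow> q = p)"

lemma order_ideal_diff_maximal:
  assumes "order_ideal Q I" "\<And>p. p \<in> M \<Longrightarrow> maximal_in Q I p"
  shows "order_ideal Q (I - M)"
  using assms unfolding order_ideal_def maximal_in_def by blast

text \<open>If \<open>I\<close> covers \<open>K\<close>, choose \<open>p\<close> maximal in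
  \<open>I - K\<close>. As \<open>K\<close> is a down-set, nothing above \<open>p\<close> lies in
  \<open>K\<close>, so \<open>p\<close> is maximal in all of \<open>I\<close>, and the ideal
  \<open>I - {p}\<close>, which lies between \<open>K\<close> and \<open>I\<close>, must be
  \<open>K\<close>.\<close>

lemma covers_ideal_lattice_iff:
  assumes "partial_order Q" "finite (carrier Q)"
  shows "covers (ideal_lattice Q) I K \<longleftrightarrow>
    order_ideal Q I \<and> (\<exists>p. maximal_in Q I p \<and> K = I - {p})"
proof
  interpret partial_order Q by fact
  assume "covers (ideal_lattice Q) I K"
  then have I: "order_ideal Q I" and K: "order_ideal Q K" and less: "K \<subset> I"
    and between: "\<And>Z. order_ideal Q Z \<Longrightarrow> K \<subset> Z \<Longrightarrow> \<not> Z \<subset> I"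
    by (auto simp: covers_def ideal_lattice_def lless_def)
  have sub: "I \<subseteq> carrier Q"
    using I by (simp add: order_ideal_def)
  have "\<exists>m\<in>I - K. \<forall>x\<in>I - K. x \<noteq> m \<longrightarrow> \<not> m \<sqsubset>\<^bsub>Q\<^esub> x"
  proof (rule Finite_Set.bex_max_element)
    show "finite (I - K)"
      using sub assms(2) finite_subset by blast
    show "asymp_on (I - K) (\<sqsubset>\<^bsub>Q\<^esub>)"
      using sub by (intro asymp_onI) (meson DiffD1 lless_antisym subsetD)
    show "transp_on (I - K) (\<sqsubset>\<^bsub>Q\<^esub>)"
      using sub by (intro transp_onI) (meson DiffD1 lless_trans subsetD)
    show "I - K \<noteq> {}"
      using less by blast
  qed
  then obtain p where p: "p \<in> I - K" "\<And>x. x \<in> I - K \<Longrightarrow> x \<noteq> p \<Longrightarrow> \<not> p \<sqsubset>\<^bsub>Q\<^esub> x"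
    by blast
  have max: "maximal_in Q I p"
    unfolding maximal_in_def
  proof (intro conjI ballI impI)
    fix q assume q: "q \<in> I" "p \<sqsubseteq>\<^bsub>Q\<^esub> q"
    then have "q \<notin> K"
      using p(1) K sub unfolding order_ideal_def by blast
    then show "q = p"
      using p(2)[of q] q by (auto simp: lless_def eq_is_equal)
  qed (use p in blast)
  have "order_ideal Q (I - {p})"
    using order_ideal_diff_maximal[OF I, of "{p}"] max by blast
  then have "K = I - {p}"
    using between[of "I - {p}"] less p(1) by blast
  then show "order_ideal Q I \<and> (\<exists>p. maximal_in Q I p \<and> K = I - {p})"
    using I max by blast
next
  assume "order_ideal Q I \<and> (\<exists>p. maximal_in Q I p \<and> K = I - {p})"
  then obtain p where p: "order_ideal Q I" "maximal_in Q I p" "K = I - {p}" by blast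
  moreover have "order_ideal Q K"
    using order_ideal_diff_maximal[OF p(1), of "{p}"] p by blast
  moreover have "p \<in> I"
    using p by (simp add: maximal_in_def)
  ultimately show "covers (ideal_lattice Q) I K"
    by (auto simp: covers_def ideal_lattice_def lless_def)
qed

lemma inf_ideal_lattice:
  assumes "A \<noteq> {}" "\<And>I. I \<in> A \<Longrightarrow> order_ideal Q I"
  shows "\<Sqinter>\<^bsub>ideal_lattice Q\<^esub> A = \<Inter> A"
proof -
  interpret lattice "ideal_lattice Q" by (rule lattice_ideal_lattice)
  have "order_ideal Q (\<Inter> A)"
    using assms unfolding order_ideal_def by blast
  then have "greatest (ideal_lattice Q) (\<Inter> A) (Lower (ideal_lattice Q) A)"
    using assms by (auto simp: greatest_def Lower_def ideal_lattice_def)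
  then show ?thesis
    unfolding inf_def by (metis someI_ex greatest_unique)
qed

text \<open>Meets are intersections and each cover omits one maximal element, so a set of covers
  amounts to a set of maximal elements deleted simultaneously.\<close>

lemma nontrivial_ungar_move_ideal_lattice_iff:
  assumes "partial_order Q" "finite (carrier Q)"
  shows "nontrivial_ungar_move (ideal_lattice Q) I K \<longleftrightarrow>
    order_ideal Q I \<and> K \<subset> I \<and> (\<forall>p\<in>I - K. maximal_in Q I p)"
proof -
  have cov: "T \<subseteq> {J. covers (ideal_lattice Q) I J} \<Longrightarrow> order_ideal Q I \<Longrightarrow>
      ungar_move (ideal_lattice Q) I T = \<Inter> (insert I T)" for T
    using inf_ideal_lattice[of "insert I T" Q]
    by (force simp: ungar_move_def covers_def ideal_lattice_def)
  show ?thesis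
  proof
    assume "nontrivial_ungar_move (ideal_lattice Q) I K"
    then obtain T where T: "T \<subseteq> {J. covers (ideal_lattice Q) I J}" "T \<noteq> {}"
      "K = ungar_move (ideal_lattice Q) I T" and I: "order_ideal Q I"
      by (auto simp: nontrivial_ungar_move_def ideal_lattice_def)
    have K: "K = \<Inter> (insert I T)"
      using cov T I by blast
    have rem: "\<exists>p. maximal_in Q I p \<and> J = I - {p}" if "J \<in> T" for J
      using T(1) that covers_ideal_lattice_iff[OF assms] by blast
    show "order_ideal Q I \<and> K \<subset> I \<and> (\<forall>p\<in>I - K. maximal_in Q I p)"
    proof (intro conjI ballI I)
      obtain J where "J \<in> T" using T(2) by blast
      then show "K \<subset> I"
        using rem[of J] K by (auto simp: maximal_in_def)
      fix p assume "p \<in> I - K"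
      then obtain J where "J \<in> T" "p \<notin> J" "p \<in> I" using K by auto
      then show "maximal_in Q I p" using rem by blast
    qed
  next
    assume R: "order_ideal Q I \<and> K \<subset> I \<and> (\<forall>p\<in>I - K. maximal_in Q I p)"
    \<comment> \<open>One cover for each deleted element.\<close>
    define T where "T = (\<lambda>p. I - {p}) ` (I - K)"
    have T: "T \<subseteq> {J. covers (ideal_lattice Q) I J}"
      using R unfolding T_def covers_ideal_lattice_iff[OF assms] by blast
    moreover have "T \<noteq> {}"
      using R unfolding T_def by blast
    moreover have "K = \<Inter> (insert I T)"
      using R unfolding T_def by auto
    moreover have "I \<in> carrier (ideal_lattice Q)"
      using R by (simp add: ideal_lattice_def)
    ultimately show "nontrivial_ungar_move (ideal_lattice Q) I K"
      using R cov[OF T] unfolding nontrivial_ungar_move_def by metis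
  qed
qed

lemma partial_order_rect_poset: "partial_order (rect_poset a b)"
  by unfold_locales (auto simp: rect_poset_def)

section \<open>The game on words\<close>

text \<open>Consuming both letters of a swapped factor keeps the swaps disjoint. No swap at all is
  allowed, so nontriviality appears later as \<open>w \<noteq> v\<close>.\<close>

inductive word_move :: "bool list \<Rightarrow> bool list \<Rightarrow> bool" where
  Nil: "word_move [] []"
| Cons: "word_move v w \<Longrightarrow> word_move (c # v) (c # w)"
| Swap: "word_move v w \<Longrightarrow> word_move (True # False # v) (False # True # w)"

lemma count_list_word_move: "word_move v w \<Longrightarrow> count_list w c = count_list v c"
  by (induction rule: word_move.induct) auto

text \<open>Swaps bring only \<open>False\<close> forward; this later excludes undoing a swap by
  another move.\<close>

lemma hd_word_move: "word_move v w \<Longrightarrow> v \<noteq> [] \<Longrightarrow> hd w \<Longrightarrow> hd v"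
  by (induction rule: word_move.induct) auto

section \<open>Automaton for the winning words\<close>

datatype state = Free | OddOnes | OddZeros | EvenZeros

text \<open>
  \<open>Free\<close>: the last run of \<open>True\<close>s is even (or absent), possibly followed by \<open>False\<close>s;
  \<open>OddOnes\<close>: inside a run of \<open>True\<close>s, odd so far; \<open>OddZeros\<close>, \<open>EvenZeros\<close>: inside a run of
  \<open>False\<close>s after an odd run of \<open>True\<close>s.
\<close>

fun accepts :: "state \<Rightarrow> bool list \<Rightarrow> bool" where
  "accepts q [] = (q \<noteq> OddZeros)"
| "accepts Free (False # w) = accepts Free w"
| "accepts Free (True # w) = accepts OddOnes w"
| "accepts OddOnes (False # w) = accepts OddZeros w"
| "accepts OddOnes (True # w) = accepts Free w"
| "accepts OddZeros (False # w) = accepts EvenZeros w"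
| "accepts OddZeros (True # w) = False"
| "accepts EvenZeros (False # w) = accepts OddZeros w"
| "accepts EvenZeros (True # w) = accepts OddOnes w"

text \<open>
  A first swap that keeps both runs alive leads to the pair \<open>OddZeros\<close>, \<open>OddOnes\<close>; the three pairs
  below are closed under all further common steps, and each has a rejecting component.
\<close>

lemma word_move_not_both_accepted:
  assumes "word_move v w"
  shows "\<not> (accepts OddZeros v \<and> accepts OddOnes w)"
    and "\<not> (accepts EvenZeros v \<and> accepts OddZeros w)"
    and "\<not> (accepts OddZeros v \<and> accepts EvenZeros w)"
proof -
  have "\<not> (accepts OddZeros v \<and> accepts OddOnes w) \<and>
    \<not> (accepts EvenZeros v \<and> accepts OddZeros w) \<and>
    \<not> (accepts OddZeros v \<and> accepts EvenZeros w)"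
    using assms
  proof (induction rule: word_move.induct)
    case (Cons v w c)
    then show ?case by (cases c) auto
  qed auto
  then show "\<not> (accepts OddZeros v \<and> accepts OddOnes w)"
    "\<not> (accepts EvenZeros v \<and> accepts OddZeros w)"
    "\<not> (accepts OddZeros v \<and> accepts EvenZeros w)" by auto
qed

text \<open>Independence of the kernel. For \<open>q = Free\<close> a swap leads to the pair
  \<open>OddZeros\<close>, \<open>OddOnes\<close> treated above; from any other state a swap makes
  one of the two words rejected at once.\<close>

lemma word_move_accepted_eq:
  assumes "word_move v w" "accepts q v" "accepts q w"
  shows "v = w"
  using assms
proof (induction arbitrary: q rule: word_move.induct)
  case (Cons v w c)
  then show ?case by (cases q; cases c) auto
next
  case (Swap v w)
  then show ?case using word_move_not_both_accepted[OF Swap.hyps] by (cases q) auto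
qed simp

section \<open>Every word has a move, possibly trivial, to an accepted word\<close>

definition can_reach :: "state \<Rightarrow> bool list \<Rightarrow> bool" where
  "can_reach q v \<longleftrightarrow> (\<exists>w. word_move v w \<and> accepts q w)"

lemma can_reach_Nil: "q \<noteq> OddZeros \<Longrightarrow> can_reach q []"
  using word_move.Nil by (auto simp: can_reach_def)

lemma can_reach_ConsI:
  assumes "can_reach q' v" "\<And>w. accepts q (c # w) = accepts q' w"
  shows "can_reach q (c # v)"
  using assms word_move.Cons by (metis can_reach_def)

lemma can_reach_SwapI:
  assumes "can_reach q' v" "\<And>w. accepts q (False # True # w) = accepts q' w"
  shows "can_reach q (True # False # v)"
  using assms word_move.Swap by (metis can_reach_def)

text \<open>Only \<open>Free\<close> is wanted; the rest is the strengthening that the induction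
  needs. The exception at \<open>OddOnes\<close> concerns a leading \<open>False\<close>: a
  preceding \<open>True\<close> can then be swapped with it, leading to \<open>OddOnes\<close>
  before \<open>u\<close>. Of \<open>EvenZeros\<close> and \<open>OddZeros\<close> only one can be
  guaranteed; either outcome serves at \<open>OddOnes\<close>, one directly, the other through the
  exception.\<close>

lemma can_reach_total:
  "(can_reach OddOnes v \<or> (\<exists>u. v = False # u \<and> can_reach OddOnes u)) \<and>
   (can_reach EvenZeros v \<or> can_reach OddZeros v) \<and> can_reach Free v"
proof (induction v rule: length_induct)
  case (1 v)
  then have odd: "can_reach OddOnes u \<or> (\<exists>t. u = False # t \<and> can_reach OddOnes t)"
    and zeros: "can_reach EvenZeros u \<or> can_reach OddZeros u"
    and free: "can_reach Free u" if "length u < length v" for u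
    using that by blast+
  have "can_reach OddOnes v \<or> (\<exists>u. v = False # u \<and> can_reach OddOnes u)"
  proof (cases v)
    case (Cons c u)
    show ?thesis
    proof (cases c)
      case True
      then show ?thesis
        using Cons free[of u] can_reach_ConsI[of Free u OddOnes True] by simp
    next
      case c: False
      show ?thesis
      proof (cases u)
        case Nil
        then show ?thesis using Cons c can_reach_Nil by simp
      next
        case u: (Cons d t)
        show ?thesis
        proof (cases d)
          case True
          then show ?thesis
            using Cons c u free[of t] can_reach_ConsI[of Free t OddOnes True] by simp
        next
          case False
          then show ?thesis
            using Cons c u zeros[of t] can_reach_ConsI[of EvenZeros t OddZeros False]
              can_reach_ConsI[of OddZeros t OddOnes False]
              can_reach_ConsI[of OddZeros u OddOnes False] by auto
        qed
      qed
    qed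
  qed (simp add: can_reach_Nil)
  moreover have "can_reach EvenZeros v \<or> can_reach OddZeros v"
  proof (cases v)
    case (Cons c u)
    show ?thesis
    proof (cases c)
      case True
      then show ?thesis
        using Cons odd[of u] can_reach_ConsI[of OddOnes u EvenZeros True]
          can_reach_SwapI[of OddOnes _ OddZeros] by auto
    next
      case False
      then show ?thesis
        using Cons zeros[of u] can_reach_ConsI[of OddZeros u EvenZeros False]
          can_reach_ConsI[of EvenZeros u OddZeros False] by auto
    qed
  qed (simp add: can_reach_Nil)
  moreover have "can_reach Free v"
  proof (cases v)
    case (Cons c u)
    show ?thesis
    proof (cases c)
      case True
      then show ?thesis
        using Cons odd[of u] can_reach_ConsI[of OddOnes u Free True]
          can_reach_SwapI[of OddOnes _ Free] by auto
    next
      case False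
      then show ?thesis
        using Cons free[of u] can_reach_ConsI[of Free u Free False] by auto
    qed
  qed (simp add: can_reach_Nil)
  ultimately show ?case by blast
qed

text \<open>This is the recursion of the game. Independence gives one direction; conversely, a
  rejected word reaches an accepted one, which is necessarily different.\<close>

lemma accepts_Free_iff:
  "accepts Free v \<longleftrightarrow> (\<forall>w. word_move v w \<and> w \<noteq> v \<longrightarrow> \<not> accepts Free w)"
  using word_move_accepted_eq[of v _ Free] can_reach_total[of v]
  by (metis can_reach_def)

section \<open>Words and order ideals of the rectangle\<close>

definition words :: "nat \<Rightarrow> nat \<Rightarrow> bool list set" where
  "words a b = {w. count_list w True = a \<and> count_list w False = b}"

text \<open>
  The box \<open>(i, j)\<close> is present iff the \<open>i\<close>-th \<open>True\<close> from the left precedes the \<open>j\<close>-th \<open>False\<close> from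
  the right (counting from \<open>0\<close>).
\<close>

fun word_ideal :: "bool list \<Rightarrow> (nat \<times> nat) set" where
  "word_ideal [] = {}"
| "word_ideal (False # w) = word_ideal w"
| "word_ideal (True # w) = {0} \<times> {..<count_list w False} \<union> map_prod Suc id ` word_ideal w"

text \<open>Membership row by row replaces the set equation for \<open>True\<close> in the
  simplifier.\<close>

lemma mem_word_ideal_True:
  "(0, j) \<in> word_ideal (True # w) \<longleftrightarrow> j < count_list w False"
  "(Suc i, j) \<in> word_ideal (True # w) \<longleftrightarrow> (i, j) \<in> word_ideal w"
  by (auto simp: image_iff) force

declare word_ideal.simps(3) [simp del] mem_word_ideal_True [simp]

lemma word_ideal_bounds:
  "(i, j) \<in> word_ideal w \<Longrightarrow> i < count_list w True \<and> j < count_list w False"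
proof (induction w arbitrary: i rule: word_ideal.induct)
  case (3 w)
  then show ?case by (cases i) auto
qed (auto intro: less_SucI)

lemma word_ideal_down:
  "(i, j) \<in> word_ideal w \<Longrightarrow> i' \<le> i \<Longrightarrow> j' \<le> j \<Longrightarrow> (i', j') \<in> word_ideal w"
proof (induction w arbitrary: i i' rule: word_ideal.induct)
  case (3 w)
  then show ?case by (cases i; cases i') (auto dest!: word_ideal_bounds)
qed auto

lemma order_ideal_word_ideal: "w \<in> words a b \<Longrightarrow> order_ideal (rect_poset a b) (word_ideal w)"
  by (auto simp: order_ideal_def rect_poset_def words_def
      dest: word_ideal_bounds intro: word_ideal_down)

lemma order_ideal_rect_poset_iff:
  "order_ideal (rect_poset a b) I \<longleftrightarrow>
    I \<subseteq> {..<a} \<times> {..<b} \<and> (\<forall>i j i' j'. (i, j) \<in> I \<longrightarrow> i' \<le> i \<longrightarrow> j' \<le> j \<longrightarrow> (i', j') \<in> I)"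
  unfolding order_ideal_def rect_poset_def by fastforce

text \<open>The first letter is read off the top row: if that row is full, remove it and write
  \<open>True\<close>; otherwise the last column is empty, so drop it and write
  \<open>False\<close>.\<close>

lemma order_ideal_rect_poset_eq_word_ideal:
  "order_ideal (rect_poset a b) I \<Longrightarrow> \<exists>w\<in>words a b. word_ideal w = I"
proof (induction "a + b" arbitrary: a b I)
  case 0
  then show ?case
    by (intro bexI[of _ "[]"]) (auto simp: words_def order_ideal_rect_poset_iff)
next
  case (Suc n)
  have I: "I \<subseteq> {..<a} \<times> {..<b}"
    and down: "\<And>i j i' j'. (i, j) \<in> I \<Longrightarrow> i' \<le> i \<Longrightarrow> j' \<le> j \<Longrightarrow> (i', j') \<in> I"
    using Suc.prems by (auto simp: order_ideal_rect_poset_iff)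
  show ?case
  proof (cases "a > 0 \<and> (b = 0 \<or> (0, b - 1) \<in> I)")
    \<comment> \<open>With \<open>b = 0\<close> the top row counts as full, so that the remaining
      letters are all \<open>True\<close>.\<close>
    case True
    then obtain a' where a: "a = Suc a'" by (cases a) auto
    have "order_ideal (rect_poset a' b) {(i, j). (Suc i, j) \<in> I}"
      using I a by (auto simp: order_ideal_rect_poset_iff intro: down)
    then obtain w where w: "w \<in> words a' b" "word_ideal w = {(i, j). (Suc i, j) \<in> I}"
      using Suc.hyps(1)[of a' b] Suc.hyps(2) a by auto
    have "word_ideal (True # w) = I"
    proof (intro Set.set_eqI)
      fix p :: "nat \<times> nat"
      obtain i j where p: "p = (i, j)" by (cases p)
      have "(0, j) \<in> I \<longleftrightarrow> j < b"
        using True I down[of 0 "b - 1" 0 j] by auto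
      then show "p \<in> word_ideal (True # w) \<longleftrightarrow> p \<in> I"
        using w unfolding p by (cases i) (auto simp: words_def)
    qed
    then show ?thesis
      using w a by (intro bexI[of _ "True # w"]) (auto simp: words_def)
  next
    case False
    then obtain b' where b: "b = Suc b'"
      using Suc.hyps(2) by (cases b) auto
    have "j \<noteq> b'" if "(i, j) \<in> I" for i j
      using False I down[OF that, of 0 j] that b by auto
    then have "order_ideal (rect_poset a b') I"
      using I b by (fastforce simp: order_ideal_rect_poset_iff less_Suc_eq intro: down)
    then obtain w where "w \<in> words a b'" "word_ideal w = I"
      using Suc.hyps(1)[of a b'] Suc.hyps(2) b by auto
    then show ?thesis
      using b by (intro bexI[of _ "False # w"]) (auto simp: words_def)
  qed
qed

section \<open>Moves on ideals compared with moves on words\<close>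

definition removal :: "(nat \<times> nat) set \<Rightarrow> (nat \<times> nat) set \<Rightarrow> bool" where
  "removal I K \<longleftrightarrow> K \<subseteq> I \<and>
    (\<forall>i j i' j'. (i, j) \<in> I \<longrightarrow> (i, j) \<notin> K \<longrightarrow> (i', j') \<in> I \<longrightarrow> i \<le> i' \<longrightarrow> j \<le> j' \<longrightarrow> i' = i \<and> j' = j)"

text \<open>\<open>removal\<close> mentions no side lengths and allows the trivial move, so that it
  passes to shorter words in the inductions below.\<close>

lemma nontrivial_ungar_move_rect_iff:
  "nontrivial_ungar_move (ideal_lattice (rect_poset a b)) I K \<longleftrightarrow>
    order_ideal (rect_poset a b) I \<and> removal I K \<and> K \<noteq> I"
proof -
  have "finite (carrier (rect_poset a b))" by (simp add: rect_poset_def)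
  note iff = nontrivial_ungar_move_ideal_lattice_iff[OF partial_order_rect_poset this]
  show ?thesis
    unfolding iff removal_def maximal_in_def by (fastforce simp: rect_poset_def)
qed

lemma removalI:
  assumes "\<And>i j. (i, j) \<in> K \<Longrightarrow> (i, j) \<in> I"
    and "\<And>i j i' j'. (i, j) \<in> I \<Longrightarrow> (i, j) \<notin> K \<Longrightarrow> (i', j') \<in> I \<Longrightarrow> i \<le> i' \<Longrightarrow> j \<le> j' \<Longrightarrow>
      i' = i \<and> j' = j"
  shows "removal I K"
  using assms unfolding removal_def by auto

lemma removal_subset: "removal I K \<Longrightarrow> (i, j) \<in> K \<Longrightarrow> (i, j) \<in> I"
  by (auto simp: removal_def)

lemma removal_maximal:
  "removal I K \<Longrightarrow> (i, j) \<in> I \<Longrightarrow> (i, j) \<notin> K \<Longrightarrow> (i', j') \<in> I \<Longrightarrow> i \<le> i' \<Longrightarrow> j \<le> j' \<Longrightarrow>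
    i' = i \<and> j' = j"
  by (auto simp: removal_def)

lemma removal_shift:
  assumes "removal I K"
  shows "removal {(i, j). (Suc i, j) \<in> I} {(i, j). (Suc i, j) \<in> K}"
proof (rule removalI)
  fix i j i' j'
  assume "(i, j) \<in> {(i, j). (Suc i, j) \<in> I}" "(i, j) \<notin> {(i, j). (Suc i, j) \<in> K}"
    "(i', j') \<in> {(i, j). (Suc i, j) \<in> I}" "i \<le> i'" "j \<le> j'"
  then show "i' = i \<and> j' = j"
    using removal_maximal[OF assms, of "Suc i" j "Suc i'" j'] by simp
qed (use removal_subset[OF assms] in simp)

text \<open>A swap deletes the last box \<open>(0, count_list v False)\<close> of the current top
  row. The later rows come from \<open>v\<close> and have at most \<open>count_list v False\<close>
  boxes, so the deleted box is maximal.\<close>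

lemma word_move_imp_removal: "word_move v w \<Longrightarrow> removal (word_ideal v) (word_ideal w)"
proof (induction rule: word_move.induct)
  case (Cons v w c)
  note cnt = count_list_word_move[OF Cons.hyps, of False]
    and sub = removal_subset[OF Cons.IH] and max = removal_maximal[OF Cons.IH]
  show ?case
  proof (cases c)
    case c: True
    show ?thesis
    proof (rule removalI)
      fix i j assume "(i, j) \<in> word_ideal (c # w)"
      then show "(i, j) \<in> word_ideal (c # v)"
        using c cnt sub by (cases i) auto
    next
      fix i j i' j'
      assume "(i, j) \<in> word_ideal (c # v)" "(i, j) \<notin> word_ideal (c # w)"
        "(i', j') \<in> word_ideal (c # v)" "i \<le> i'" "j \<le> j'"
      then show "i' = i \<and> j' = j"
        using c cnt max by (cases i; cases i') auto
    qed
  qed (use Cons.IH in simp)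
next
  case (Swap v w)
  note cnt = count_list_word_move[OF Swap.hyps, of False]
    and sub = removal_subset[OF Swap.IH] and max = removal_maximal[OF Swap.IH]
  show ?case
  proof (rule removalI)
    fix i j assume "(i, j) \<in> word_ideal (False # True # w)"
    then show "(i, j) \<in> word_ideal (True # False # v)"
      using cnt sub by (cases i) auto
  next
    fix i j i' j'
    assume "(i, j) \<in> word_ideal (True # False # v)" "(i, j) \<notin> word_ideal (False # True # w)"
      "(i', j') \<in> word_ideal (True # False # v)" "i \<le> i'" "j \<le> j'"
    then show "i' = i \<and> j' = j"
      using cnt max word_ideal_bounds[of "i' - 1" j' v] by (cases i; cases i') auto
  qed
qed (simp add: removal_def)

text \<open>Compare first letters. A first difference must be \<open>True\<close> against
  \<open>False\<close>, since the top row can only shrink; maximality of the deleted boxes then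
  determines the second letters.\<close>

lemma removal_imp_word_move:
  "removal (word_ideal v) (word_ideal w) \<Longrightarrow> count_list w True = count_list v True \<Longrightarrow>
    count_list w False = count_list v False \<Longrightarrow> word_move v w"
proof (induction v arbitrary: w rule: length_induct)
  case (1 v)
  note R = 1(2) and cnt = 1(3,4)
  note sub = removal_subset[OF R] and max = removal_maximal[OF R]
  show ?case
  proof (cases v)
    case Nil
    then have "w = []" using cnt by (cases w) (auto split: if_splits)
    then show ?thesis using Nil word_move.Nil by simp
  next
    case v: (Cons c v')
    have "w \<noteq> []" using cnt v by (cases c) auto
    then obtain d w' where w: "w = d # w'" by (cases w) auto
    have IH: "\<And>u t. length u < length v \<Longrightarrow> removal (word_ideal u) (word_ideal t) \<Longrightarrow>
        count_list t True = count_list u True \<Longrightarrow> count_list t False = count_list u False \<Longrightarrow>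
        word_move u t"
      using 1(1) by blast
    consider "c = d" | "\<not> c" "d" | "c" "\<not> d" by blast
    then show ?thesis
    proof cases
      case 1
      have "removal (word_ideal v') (word_ideal w')"
        using R removal_shift[OF R] v w 1 by (cases d) auto
      then have "word_move v' w'"
        using IH[of v' w'] v w 1 cnt by (auto split: if_splits)
      then show ?thesis using v w 1 word_move.Cons by simp
    next
      case 2
      \<comment> \<open>The top row of \<open>w\<close> would have one box more than
        \<open>v'\<close> has columns.\<close>
      then have "(0, count_list v' False) \<in> word_ideal v"
        using sub v w cnt by auto
      then show ?thesis
        using v 2 word_ideal_bounds by fastforce
    next
      case 3
      define k where "k = count_list w' False"
      have cv: "count_list v' False = Suc k" "count_list w' True = Suc (count_list v' True)"
        using cnt v w 3 unfolding k_def by auto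
      have top: "(0, k) \<in> word_ideal v" "(0, k) \<notin> word_ideal w"
        using v w 3 cv word_ideal_bounds[of 0 k w'] by (auto simp: k_def)
      then have "(1, k) \<notin> word_ideal v"
        using max[of 0 k 1 k] by auto
      then have nk: "(0, k) \<notin> word_ideal v'"
        using v 3 by simp
      have "v' \<noteq> []" using cv by auto
      then obtain e u where u: "v' = e # u" by (cases v') auto
      \<comment> \<open>A second \<open>True\<close> would give the next row the same length,
        leaving \<open>(0, k)\<close> not maximal.\<close>
      have e: "\<not> e"
        using nk u cv by (cases e) auto
      have "w' \<noteq> []" using cv by auto
      then obtain f t where t: "w' = f # t" by (cases w') auto
      \<comment> \<open>A second \<open>False\<close> would delete \<open>(0, k - 1)\<close>
        together with \<open>(0, k)\<close>, and the former is not maximal.\<close>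
      have f: "f"
      proof (rule ccontr)
        assume nf: "\<not> f"
        then have "(0, k - 1) \<notin> word_ideal w" "k > 0"
          using t w 3 word_ideal_bounds[of 0 "k - 1" t] by (auto simp: k_def)
        moreover from this have "(0, k - 1) \<in> word_ideal v"
          using v 3 cv by auto
        ultimately show False
          using max[of 0 "k - 1" 0 k] top by auto
      qed
      have "removal (word_ideal u) (word_ideal t)"
        using removal_shift[OF R] v w u t e f 3 by simp
      then have "word_move u t"
        using IH[of u t] v w u t e f 3 cnt by auto
      then show ?thesis
        using v w u t e f 3 word_move.Swap by simp
    qed
  qed
qed

lemma removal_word_ideal_iff:
  assumes "v \<in> words a b" "w \<in> words a b"
  shows "removal (word_ideal v) (word_ideal w) \<longleftrightarrow> word_move v w"
  using assms word_move_imp_removal removal_imp_word_move by (auto simp: words_def)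

text \<open>Equal ideals give moves in both directions, and the first swap of one could not be
  undone by the other because of \<open>hd_word_move\<close>.\<close>

lemma inj_on_word_ideal: "inj_on word_ideal (words a b)"
proof (rule inj_onI)
  fix v w
  assume vw: "v \<in> words a b" "w \<in> words a b" "word_ideal v = word_ideal w"
  have "word_move v w" "word_move w v"
    using vw removal_word_ideal_iff[of v a b w] removal_word_ideal_iff[of w a b v]
    by (auto simp: removal_def)
  then show "v = w"
  proof (induction rule: word_move.induct)
    case (Cons v w c)
    from Cons.prems show ?case
      by cases (use Cons in auto)
  next
    case (Swap v w)
    then show ?case
      using hd_word_move[of "False # True # w" "True # False # v"] by simp
  qed simp
qed

text \<open>Winning and acceptance obey the same recursion, by \<open>mem_eeta_wins_iff\<close> and
  \<open>accepts_Free_iff\<close>; nontrivial moves shrink the ideal, so induction on its size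
  applies.\<close>

lemma eeta_wins_rect:
  "eeta_wins (ideal_lattice (rect_poset a b)) = word_ideal ` {w \<in> words a b. accepts Free w}"
proof -
  let ?L = "ideal_lattice (rect_poset a b)"
  have fin: "finite (carrier ?L)"
    by (rule finite_ideal_lattice) (simp add: rect_poset_def)
  have oi: "word_ideal w \<in> carrier ?L" if "w \<in> words a b" for w
    using order_ideal_word_ideal[OF that] by (simp add: ideal_lattice_def)
  have key: "word_ideal v \<in> eeta_wins ?L \<longleftrightarrow> accepts Free v" if "v \<in> words a b" for v
    using that
  proof (induction "card (word_ideal v)" arbitrary: v rule: less_induct)
    case less
    have finv: "finite (word_ideal v)"
      by (rule finite_subset[of _ "{..<count_list v True} \<times> {..<count_list v False}"])
        (auto dest: word_ideal_bounds)
    have move: "nontrivial_ungar_move ?L (word_ideal v) (word_ideal w) \<longleftrightarrow> word_move v w \<and> w \<noteq> v"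
      if "w \<in> words a b" for w
      using nontrivial_ungar_move_rect_iff order_ideal_word_ideal[OF less.prems]
        removal_word_ideal_iff[OF less.prems that] inj_on_word_ideal[of a b] less.prems that
      by (auto dest: inj_onD)
    have IH: "word_ideal w \<in> eeta_wins ?L \<longleftrightarrow> accepts Free w"
      if "w \<in> words a b" "word_move v w" "w \<noteq> v" for w
    proof (rule less.hyps)
      have "word_ideal w \<subset> word_ideal v"
        using that move[of w] nontrivial_ungar_move_rect_iff by (auto simp: removal_def)
      then show "card (word_ideal w) < card (word_ideal v)"
        using finv by (rule psubset_card_mono[rotated])
    qed fact
    have "word_ideal v \<in> eeta_wins ?L \<longleftrightarrow>
        (\<forall>K. nontrivial_ungar_move ?L (word_ideal v) K \<longrightarrow> K \<notin> eeta_wins ?L)"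
      by (rule mem_eeta_wins_iff[OF lattice_ideal_lattice fin oi[OF less.prems]])
    also have "\<dots> \<longleftrightarrow> (\<forall>w\<in>words a b. nontrivial_ungar_move ?L (word_ideal v) (word_ideal w) \<longrightarrow>
        word_ideal w \<notin> eeta_wins ?L)"
    proof -
      \<comment> \<open>Every target of a move is again an ideal of the rectangle, hence comes from
        a word.\<close>
      have "\<exists>w\<in>words a b. word_ideal w = K"
        if "nontrivial_ungar_move ?L (word_ideal v) K" for K
        using nontrivial_ungar_move_less(1)[OF lattice_ideal_lattice fin that]
        by (auto simp: ideal_lattice_def intro: order_ideal_rect_poset_eq_word_ideal)
      then show ?thesis by blast
    qed
    also have "\<dots> \<longleftrightarrow> (\<forall>w. word_move v w \<and> w \<noteq> v \<longrightarrow> \<not> accepts Free w)"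
      using move IH less.prems count_list_word_move by (auto simp: words_def)
    also have "\<dots> \<longleftrightarrow> accepts Free v"
      by (rule accepts_Free_iff[symmetric])
    finally show ?case .
  qed
  show ?thesis
  proof (intro Set.set_eqI iffI)
    fix I assume I: "I \<in> eeta_wins ?L"
    then have "order_ideal (rect_poset a b) I"
      by (simp add: eeta_wins_def ideal_lattice_def)
    then obtain w where "w \<in> words a b" "word_ideal w = I"
      using order_ideal_rect_poset_eq_word_ideal by blast
    then show "I \<in> word_ideal ` {w \<in> words a b. accepts Free w}"
      using key[of w] I by auto
  qed (auto simp: key)
qed

section \<open>The generating function\<close>

definition word_gf :: "(bool list \<Rightarrow> bool) \<Rightarrow> rat fps fps" where
  "word_gf P = bivariate_gf (\<lambda>a b. of_nat (card {w \<in> words a b. P w}))"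

lemma finite_words: "finite (words a b)"
proof (rule finite_subset)
  show "words a b \<subseteq> {w. set w \<subseteq> UNIV \<and> length w = a + b}"
  proof
    fix w :: "bool list" assume "w \<in> words a b"
    moreover have "length w = count_list w True + count_list w False"
      by (induction w) auto
    ultimately show "w \<in> {w. set w \<subseteq> UNIV \<and> length w = a + b}"
      by (simp add: words_def)
  qed
qed (rule finite_lists_length_eq, simp)

text \<open>Split by the first letter. The guards are there because \<open>0 - 1 = 0\<close> in the
  naturals.\<close>

lemma card_words_step:
  "card {w \<in> words a b. P w} = (if a = 0 \<and> b = 0 \<and> P [] then 1 else 0) +
    (if b = 0 then 0 else card {w \<in> words a (b - 1). P (False # w)}) +
    (if a = 0 then 0 else card {w \<in> words (a - 1) b. P (True # w)})"
proof -
  let ?E = "if a = 0 \<and> b = 0 \<and> P [] then {[]} else {} :: bool list set"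
  let ?F = "if b = 0 then {} else {w \<in> words a (b - 1). P (False # w)}"
  let ?T = "if a = 0 then {} else {w \<in> words (a - 1) b. P (True # w)}"
  have "w \<in> {w \<in> words a b. P w} \<longleftrightarrow> w \<in> ?E \<union> Cons False ` ?F \<union> Cons True ` ?T" for w
  proof (cases w)
    case (Cons c v)
    then show ?thesis by (cases c) (auto simp: words_def)
  qed (auto simp: words_def)
  then have "{w \<in> words a b. P w} = ?E \<union> (Cons False ` ?F \<union> Cons True ` ?T)"
    by blast
  also have "card \<dots> = card ?E + (card (Cons False ` ?F) + card (Cons True ` ?T))"
    by (subst card_Un_disjoint; (subst card_Un_disjoint)?) (auto simp: finite_words)
  also have "card (Cons False ` ?F) = card ?F"
    by (rule card_image) simp
  also have "card (Cons True ` ?T) = card ?T"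
    by (rule card_image) simp
  finally show ?thesis by auto
qed

text \<open>Applied to the states of the automaton, this yields the linear system for the generating
  functions.\<close>

lemma word_gf_step:
  "word_gf P = (if P [] then 1 else 0) + fps_x * word_gf (\<lambda>w. P (False # w)) +
    fps_y * word_gf (\<lambda>w. P (True # w))"
proof (intro fps_ext)
  fix a b
  show "fps_nth (fps_nth (word_gf P) a) b =
    fps_nth (fps_nth ((if P [] then 1 else 0) + fps_x * word_gf (\<lambda>w. P (False # w)) +
      fps_y * word_gf (\<lambda>w. P (True # w))) a) b"
    unfolding word_gf_def bivariate_gf_def fps_x_def fps_y_def
    by (simp add: card_words_step[of a b P])
qed

lemma word_gf_False: "word_gf (\<lambda>w. False) = 0"
  by (intro fps_ext) (simp add: word_gf_def bivariate_gf_def)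

theorem theorem1p8:
  shows "bivariate_gf (\<lambda>a b. of_nat (card (eeta_wins (ideal_lattice (rect_poset a b))))) =
    ((1 + fps_x) * (1 + fps_y)) / (1 - (1 + fps_x) * fps_y\<^sup>2 - (1 + fps_y) * fps_x\<^sup>2)"
proof -
  define x y where "x = fps_x" and "y = fps_y"
  define A B C D where "A = word_gf (accepts Free)" and "B = word_gf (accepts OddOnes)"
    and "C = word_gf (accepts OddZeros)" and "D = word_gf (accepts EvenZeros)"
  \<comment> \<open>One equation per state. That for \<open>C\<close> has no constant and no
    \<open>y\<close> term: \<open>OddZeros\<close> rejects the empty word and every word beginning
    with \<open>True\<close>.\<close>
  have A: "A = 1 + x * A + y * B" and B: "B = 1 + x * C + y * A"
    and C: "C = x * D" and D: "D = 1 + x * C + y * B"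
    unfolding A_def B_def C_def D_def x_def y_def
    by (subst word_gf_step; simp add: word_gf_False)+
  \<comment> \<open>The equations for \<open>A\<close>, \<open>C\<close> and \<open>D\<close> give
    \<open>(1 - x) * (1 + x) * D = 1 + y * B = (1 - x) * A\<close>, so eliminating \<open>D\<close>
    brings in the factor \<open>1 - x\<close>, which is cancelled below.\<close>
  have "(1 - x) * (A * (1 - (1 + x) * y\<^sup>2 - (1 + y) * x\<^sup>2)) = (1 - x) * ((1 + x) * (1 + y))"
    using A B C D by algebra
  moreover have "fps_nth (fps_nth x 0) 1 \<noteq> fps_nth (fps_nth 1 0) 1"
    by (simp add: x_def fps_x_def)
  then have "1 - x \<noteq> 0"
    by (metis eq_iff_diff_eq_0)
  ultimately have "A * (1 - (1 + x) * y\<^sup>2 - (1 + y) * x\<^sup>2) = (1 + x) * (1 + y)"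
    by simp
  moreover have "bivariate_gf (\<lambda>a b. of_nat (card (eeta_wins (ideal_lattice (rect_poset a b))))) = A"
  proof -
    have "card (eeta_wins (ideal_lattice (rect_poset a b))) = card {w \<in> words a b. accepts Free w}"
      for a b
      unfolding eeta_wins_rect
      by (intro card_image inj_on_subset[OF inj_on_word_ideal]) auto
    then show ?thesis by (simp add: A_def word_gf_def)
  qed
  ultimately show ?thesis
    unfolding x_def y_def
    using eq_divide_iff_fps_fps[of "1 - (1 + fps_x) * fps_y\<^sup>2 - (1 + fps_y) * fps_x\<^sup>2"]
      denominator_unit by auto
qed

end
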